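(* Let $k>0$ be real and $\alpha,\beta,\beta',\gamma,x,y\in\mathbb{C}$ with $\Re(\gamma)>\Re(\alpha)>0$, $|x|<\frac1k$, $|y|<\frac1k$, $\left|\frac{x}{1-kx}\right|<\frac1k$ and $\left|\frac{y}{1-ky}\right|<\frac1k$. Then $$F_{1,k}(\alpha,\beta,\beta';\gamma;x,y)=(1-kx)^{-\frac{\beta}{k}}(1-ky)^{-\frac{\beta'}{k}}F_{1,k}\left(\gamma-\alpha,\beta,\beta';\gamma;-\frac{x}{1-kx},-\frac{y}{1-ky}\right).$$
   Context: For real $k>0$, $a\in\mathbb{C}$ and an integer $n\ge 1$, the Pochhammer $k$-symbol is $(a)_{n,k}=a(a+k)(a+2k)\cdots(a+(n-1)k)$, and $(a)_{0,k}=1$. The first Appell $k$-function is $$F_{1,k}(\alpha,\beta,\beta';\gamma;x,y)=\sum_{m,n=0}^\infty\frac{(\alpha)_{m+n,k}(\beta)_{m,k}(\beta')_{n,k}}{(\gamma)_{m+n,k}}\frac{x^m}{m!}\frac{y^n}{n!},\qquad |x|<\tfrac1k,\ |y|<\tfrac1k.$$ Complex powers are principal values. *)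

theory Defs
  imports "HOL-Analysis.Analysis"
begin

definition pochhammer_k :: "real \<Rightarrow> complex \<Rightarrow> nat \<Rightarrow> complex" where
  "pochhammer_k k a n = (\<Prod>i<n. a + of_nat i * of_real k)"

text \<open>
  The double series is read as an unordered sum over all pairs of indices. It converges
  absolutely for \<open>norm x < 1 / k\<close>, \<open>norm y < 1 / k\<close> whenever no factor \<open>\<gamma> + i * k\<close>
  vanishes; \<^const>\<open>infsum\<close> gives 0 if the family is not summable.
\<close>

definition appell_F1_k ::
  "real \<Rightarrow> complex \<Rightarrow> complex \<Rightarrow> complex \<Rightarrow> complex \<Rightarrow> complex \<Rightarrow> complex \<Rightarrow> complex" where
  "appell_F1_k k \<alpha> \<beta> \<beta>' \<gamma> x y =
     (\<Sum>\<^sub>\<infinity>(m, n)\<in>UNIV.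
        pochhammer_k k \<alpha> (m + n) * pochhammer_k k \<beta> m * pochhammer_k k \<beta>' n
          / pochhammer_k k \<gamma> (m + n) * (x ^ m / fact m) * (y ^ n / fact n))"

end

theory Submission
  imports Defs
begin

text \<open>
  Scaling by \<open>k\<close> turns every Pochhammer \<open>k\<close>-symbol into a power of \<open>k\<close> times an ordinary
  Pochhammer symbol, so that with \<open>a = \<alpha> / k\<close>, \<open>b = \<beta> / k\<close>, \<open>b' = \<beta>' / k\<close>, \<open>c = \<gamma> / k\<close>,
  \<open>X = k x\<close>, \<open>Y = k y\<close> the function becomes the classical Appell series
  (lemma \<open>appell_F1_k_eq_binomial_terms\<close>).

  Classically one writes that series as the mean of \<open>(1 - t X)\<^sup>-\<^sup>b (1 - t Y)\<^sup>-\<^sup>b\<^sup>'\<close> with respect to the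
  Beta density proportional to \<open>t\<^sup>a\<^sup>-\<^sup>1 (1 - t)\<^sup>c\<^sup>-\<^sup>a\<^sup>-\<^sup>1\<close> on \<open>[0, 1]\<close> and substitutes \<open>1 - t\<close> for \<open>t\<close>.
  The proof below keeps this idea but replaces the integral by its moments: all that matters is
  the linear functional \<open>L\<close> on polynomials with \<open>L(t\<^sup>n) = (a)\<^sub>n / (c)\<^sub>n\<close>. Induction gives
  \<open>L(t\<^sup>i (1 - t)\<^sup>l) = (a)\<^sub>i (c - a)\<^sub>l / (c)\<^sub>i\<^sub>+\<^sub>l\<close>, a formula in which replacing \<open>t\<close> by \<open>1 - t\<close> is the
  exchange of \<open>a\<close> and \<open>c - a\<close>.

  Passing directly from powers of \<open>t\<close> to powers of \<open>1 - t\<close> leads to double series that need not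
  converge absolutely, since each end point of \<open>[0, 1]\<close> is at distance \<open>1\<close> from the other. Passing
  from either end point to the midpoint is harmless. With \<open>s = 2 t - 1\<close>,
  \[ 1 - t X = (1 - X / 2) (1 - s Z), \qquad Z = X / (2 - X), \]
  and the centred moments \<open>L(s\<^sup>n)\<close> are bounded (lemma \<open>centred_moment_bounded\<close>), since \<open>s\<^sup>n\<close> is
  a signed sum of terms \<open>t\<^sup>i (1 - t)\<^sup>l\<close> and the absolute values of their moments are controlled by
  a positive Beta distribution. Hence for all \<open>X\<close>, \<open>Y\<close> in the unit disc the Appell series equals
  \<open>(1 - X / 2)\<^sup>-\<^sup>b (1 - Y / 2)\<^sup>-\<^sup>b\<^sup>'\<close> times a series in \<open>Z\<close> and \<open>W = Y / (2 - Y)\<close> whose coefficients contain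
  the centred moments (lemma \<open>appell_series_recentred\<close>).

  The right-hand side of the claim has the parameter \<open>c - a\<close> in place of \<open>a\<close> and the arguments
  \<open>X' = - X / (1 - X)\<close>, \<open>Y' = - Y / (1 - Y)\<close>. The former multiplies the \<open>n\<close>-th centred moment by
  \<open>(- 1)\<^sup>n\<close>, the latter change \<open>Z\<close> and \<open>W\<close> into \<open>- Z\<close> and \<open>- W\<close>; so the recentred series of both
  sides coincide. The prefactors match because \<open>1 - X / 2 = (1 - X) (1 - X' / 2)\<close>, where all
  factors lie in the right half plane and principal powers are multiplicative.
\<close>

section \<open>Moments of the complex Beta distribution\<close>

text \<open>
  For \<open>0 < Re a < Re c\<close> this is integration against the normalised Beta density with parameters
  \<open>a\<close> and \<open>c - a\<close>. Prescribing the values on powers avoids evaluating the Beta integral for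
  complex parameters.
\<close>

definition beta_functional :: "complex \<Rightarrow> complex \<Rightarrow> complex poly \<Rightarrow> complex" where
  "beta_functional a c p = (\<Sum>i\<le>degree p. coeff p i * (pochhammer a i / pochhammer c i))"

lemma beta_functional_eq_sum:
  assumes "degree p \<le> n"
  shows "beta_functional a c p = (\<Sum>i\<le>n. coeff p i * (pochhammer a i / pochhammer c i))"
  unfolding beta_functional_def
  by (intro sum.mono_neutral_left) (use assms in \<open>auto simp: not_le coeff_eq_0\<close>)

lemma beta_functional_add:
  "beta_functional a c (p + q) = beta_functional a c p + beta_functional a c q"
proof -
  define n where "n = max (degree p) (degree q)"
  have "degree (p + q) \<le> n" "degree p \<le> n" "degree q \<le> n"
    by (auto simp: n_def degree_add_le_max)
  thus ?thesis
    by (simp add: beta_functional_eq_sum[of _ n] ring_distribs add_divide_distrib sum.distrib)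
qed

lemma beta_functional_smult:
  "beta_functional a c (smult r p) = r * beta_functional a c p"
  by (simp add: beta_functional_eq_sum[of _ "degree p"] degree_smult_le sum_distrib_left mult_ac)

lemma beta_functional_sum:
  "beta_functional a c (\<Sum>i\<in>A. f i) = (\<Sum>i\<in>A. beta_functional a c (f i))"
proof (induction A rule: infinite_finite_induct)
  case (insert i A)
  thus ?case by (simp add: beta_functional_add)
qed (simp_all add: beta_functional_def)

lemma beta_functional_monom:
  "beta_functional a c (monom 1 n) = pochhammer a n / pochhammer c n"
proof -
  have "beta_functional a c (monom 1 n) =
          (\<Sum>i\<le>n. if i = n then pochhammer a i / pochhammer c i else 0)"
    unfolding beta_functional_eq_sum[OF degree_monom_le] by (intro sum.cong) auto
  thus ?thesis by simp
qed

lemma pochhammer_nonzero_of_Re_pos: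
  assumes "Re c > 0"
  shows "pochhammer c n \<noteq> 0"
proof
  assume "pochhammer c n = 0"
  then obtain k where "c = - of_nat k" by (auto simp: pochhammer_eq_0_iff)
  with assms show False by simp
qed

text \<open>
  The symmetry between \<open>a\<close> and \<open>c - a\<close> becomes visible on Bernstein polynomials. The induction
  writes one factor \<open>1 - t\<close> as a difference, and the two resulting terms combine because
  \<open>(c + i + l) - (a + i) = (c - a) + l\<close>.
\<close>

lemma beta_functional_bernstein:
  assumes "Re c > 0"
  shows "beta_functional a c (monom 1 i * [:1, -1:] ^ l) =
           pochhammer a i * pochhammer (c - a) l / pochhammer c (i + l)"
proof (induction l arbitrary: i)
  case 0
  thus ?case by (simp add: beta_functional_monom)
next
  case (Suc l)
  have "monom 1 i * [:1, -1:] ^ Suc l =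
          monom 1 i * [:1, -1:] ^ l + smult (-1) (monom 1 (Suc i) * [:1, -1 :: complex:] ^ l)"
    by (simp add: algebra_simps monom_Suc)
  hence "beta_functional a c (monom 1 i * [:1, -1:] ^ Suc l) =
           pochhammer a i * pochhammer (c - a) l / pochhammer c (i + l)
           - pochhammer a (Suc i) * pochhammer (c - a) l / pochhammer c (Suc i + l)"
    by (simp only: beta_functional_add beta_functional_smult Suc.IH) simp
  also have "\<dots> = pochhammer a i * pochhammer (c - a) (Suc l) / pochhammer c (i + Suc l)"
    using pochhammer_nonzero_of_Re_pos[OF assms, of "i + l"]
      pochhammer_nonzero_of_Re_pos[OF assms, of "Suc (i + l)"]
    by (simp add: pochhammer_Suc divide_simps) (simp add: algebra_simps)
  finally show ?case .
qed

section \<open>Moments centred at the midpoint\<close>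

definition centred_moment :: "complex \<Rightarrow> complex \<Rightarrow> nat \<Rightarrow> complex" where
  "centred_moment a c n = beta_functional a c ([:-1, 2:] ^ n)"

text \<open>
  The binomial expansion of \<open>2 t - 1 = t - (1 - t)\<close>.
\<close>

lemma centred_moment_eq_sum:
  assumes "Re c > 0"
  shows "centred_moment a c n =
    (\<Sum>i\<le>n. of_nat (n choose i) * (-1) ^ (n - i) *
       (pochhammer a i * pochhammer (c - a) (n - i) / pochhammer c n))"
proof -
  have "[:-1, 2 :: complex:] = monom 1 1 + (- [:1, -1:])"
    by (simp add: monom_altdef)
  hence "[:-1, 2 :: complex:] ^ n =
     (\<Sum>i\<le>n. of_nat (n choose i) * monom 1 1 ^ i * (- [:1, -1:]) ^ (n - i))"
    by (simp only: binomial_ring)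
  also have "\<dots> = (\<Sum>i\<le>n. smult (of_nat (n choose i) * (-1) ^ (n - i))
                     (monom 1 i * [:1, -1:] ^ (n - i)))"
  proof (rule sum.cong)
    fix i
    have "(- [:1, -1 :: complex:]) ^ (n - i) = smult ((-1) ^ (n - i)) ([:1, -1:] ^ (n - i))"
      by (metis smult_power smult_minus_left smult_1_left)
    moreover have "(monom 1 1 :: complex poly) ^ i = monom 1 i"
      by (simp add: monom_power)
    ultimately show "of_nat (n choose i) * monom 1 1 ^ i * (- [:1, -1 :: complex:]) ^ (n - i) =
       smult (of_nat (n choose i) * (-1) ^ (n - i)) (monom 1 i * [:1, -1:] ^ (n - i))"
      by (simp add: of_nat_poly mult.commute)
  qed simp
  finally show ?thesis
    by (simp add: centred_moment_def beta_functional_sum beta_functional_smult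
        beta_functional_bernstein[OF assms])
qed

lemma centred_moment_reflect:
  assumes "Re c > 0"
  shows "centred_moment (c - a) c n = (-1) ^ n * centred_moment a c n"
proof -
  have "centred_moment (c - a) c n =
    (\<Sum>i\<le>n. of_nat (n choose i) * (-1) ^ (n - i) *
       (pochhammer (c - a) i * pochhammer a (n - i) / pochhammer c n))"
    by (subst centred_moment_eq_sum[OF assms]) simp
  also have "\<dots> = (\<Sum>i\<le>n. of_nat (n choose i) * (-1) ^ i *
       (pochhammer a i * pochhammer (c - a) (n - i) / pochhammer c n))"
    by (rule sum.reindex_bij_witness[of _ "\<lambda>i. n - i" "\<lambda>i. n - i"])
       (auto simp: binomial_symmetric[symmetric])
  also have "\<dots> = (-1) ^ n * (\<Sum>i\<le>n. of_nat (n choose i) * (-1) ^ (n - i) *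
       (pochhammer a i * pochhammer (c - a) (n - i) / pochhammer c n))"
    unfolding sum_distrib_left
  proof (rule sum.cong)
    fix i assume "i \<in> {..n}"
    hence "(-1 :: complex) ^ i = (-1) ^ n * (-1) ^ (n - i)"
      by (metis (no_types) atMost_iff diff_diff_cancel le_add_diff_inverse left_minus_one_mult_self
          mult.commute power_add)
    thus "of_nat (n choose i) * (-1) ^ i *
       (pochhammer a i * pochhammer (c - a) (n - i) / pochhammer c n) =
       (-1) ^ n * (of_nat (n choose i) * (-1) ^ (n - i) *
       (pochhammer a i * pochhammer (c - a) (n - i) / pochhammer c n))"
      by simp
  qed simp
  also have "\<dots> = (-1) ^ n * centred_moment a c n"
    by (simp add: centred_moment_eq_sum[OF assms])
  finally show ?thesis .
qed

lemma norm_pochhammer_ge: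
  assumes "Re c > 0"
  shows "pochhammer (Re c) n \<le> norm (pochhammer c n)"
  unfolding pochhammer_prod prod_norm[symmetric]
proof (intro prod_mono conjI)
  fix i
  show "0 \<le> Re c + of_nat i" using assms by simp
  show "Re c + of_nat i \<le> norm (c + of_nat i)"
    using complex_Re_le_cmod[of "c + of_nat i"] by simp
qed

text \<open>
  The quotient of \<open>norm (pochhammer a n)\<close> by \<open>pochhammer (Re a) n\<close> is a quotient of partial products
  of \<open>1 / \<Gamma>(a)\<close> and \<open>1 / \<Gamma>(Re a)\<close>, in which the powers of \<open>n\<close> have equal modulus and cancel; it
  therefore converges.
\<close>

lemma norm_pochhammer_le:
  assumes "Re a > 0"
  obtains K where "K > 0" "\<And>n. norm (pochhammer a n) \<le> K * pochhammer (Re a) n"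
proof -
  have "(\<lambda>n. norm (rGamma_series a n)) \<longlonglongrightarrow> norm (rGamma a)"
    by (intro tendsto_intros)
  moreover have "(\<lambda>n. rGamma_series (Re a) n) \<longlonglongrightarrow> rGamma (Re a)"
    by (intro tendsto_intros)
  moreover have "rGamma (Re a) \<noteq> 0"
    using assms by (auto simp: rGamma_eq_zero_iff elim!: nonpos_Ints_cases)
  ultimately have "Bseq (\<lambda>n. norm (rGamma_series a n) / rGamma_series (Re a) n)"
    by (intro convergent_imp_Bseq convergentI[OF tendsto_divide])
  then obtain K where K: "K > 0"
    "\<And>n. norm (norm (rGamma_series a n) / rGamma_series (Re a) n) \<le> K"
    by (auto simp: Bseq_def)
  have ratio: "norm (rGamma_series a n) / rGamma_series (Re a) n =
           norm (pochhammer a (Suc n)) / pochhammer (Re a) (Suc n)" for n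
    by (simp add: rGamma_series_def norm_divide norm_mult divide_simps)
  have "norm (pochhammer a n) \<le> max 1 K * pochhammer (Re a) n" for n
  proof (cases n)
    case (Suc m)
    have pos: "pochhammer (Re a) (Suc m) > 0"
      using assms by (rule pochhammer_pos)
    have "norm (pochhammer a (Suc m)) / pochhammer (Re a) (Suc m) \<le> max 1 K"
      using K(2)[of m] pos by (simp add: ratio le_max_iff_disj)
    with pos Suc show ?thesis by (simp add: divide_simps)
  qed simp
  thus ?thesis by (intro that[of "max 1 K"]) auto
qed

text \<open>
  Up to constants, each Pochhammer symbol may be replaced by the one of its real part. What
  remains is the sum of the moments of the Bernstein basis for a real Beta distribution, which is
  the total mass \<open>1\<close> by Vandermonde's identity.
\<close>

lemma centred_moment_bounded:
  assumes "Re a > 0" "Re c > Re a"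
  obtains K where "\<And>n. norm (centred_moment a c n) \<le> K"
proof -
  obtain K where K: "K > 0" "\<And>n. norm (pochhammer a n) \<le> K * pochhammer (Re a) n"
    using norm_pochhammer_le[OF assms(1)] by blast
  have "Re (c - a) > 0" using assms by simp
  then obtain K' where K': "K' > 0"
      "\<And>n. norm (pochhammer (c - a) n) \<le> K' * pochhammer (Re (c - a)) n"
    using norm_pochhammer_le by blast
  have c: "Re c > 0" using assms by simp
  have "norm (centred_moment a c n) \<le> K * K'" for n
  proof -
    have pos: "pochhammer (Re c) n > 0" by (rule pochhammer_pos[OF c])
    have "norm (centred_moment a c n) \<le> (\<Sum>i\<le>n. norm (of_nat (n choose i) * (-1) ^ (n - i) *
       (pochhammer a i * pochhammer (c - a) (n - i) / pochhammer c n)))"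
      unfolding centred_moment_eq_sum[OF c] by (rule norm_sum)
    also have "\<dots> \<le> (\<Sum>i\<le>n. of_nat (n choose i) *
       ((K * pochhammer (Re a) i) * (K' * pochhammer (Re (c - a)) (n - i)) / pochhammer (Re c) n))"
    proof (rule sum_mono)
      fix i
      have "norm (pochhammer a i) * norm (pochhammer (c - a) (n - i)) / norm (pochhammer c n)
        \<le> (K * pochhammer (Re a) i) * (K' * pochhammer (Re (c - a)) (n - i)) / pochhammer (Re c) n"
        using K K' pos assms
        by (intro frac_le mult_mono norm_pochhammer_ge[OF c]) (auto intro!: mult_nonneg_nonneg pochhammer_nonneg)
      thus "norm (of_nat (n choose i) * (-1) ^ (n - i) *
         (pochhammer a i * pochhammer (c - a) (n - i) / pochhammer c n)) \<le> of_nat (n choose i) *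
       ((K * pochhammer (Re a) i) * (K' * pochhammer (Re (c - a)) (n - i)) / pochhammer (Re c) n)"
        by (simp add: norm_mult norm_divide norm_power mult_left_mono del: times_divide_eq_right)
    qed
    also have "\<dots> = K * K' * (pochhammer (Re a + Re (c - a)) n / pochhammer (Re c) n)"
      unfolding pochhammer_binomial_sum sum_distrib_left sum_divide_distrib
      by (intro sum.cong refl) (simp only: times_divide_eq_right mult_ac)
    also have "\<dots> = K * K'" using pos by simp
    finally show ?thesis .
  qed
  thus ?thesis by (rule that)
qed

text \<open>
  Both powers in \<open>(2 t)\<^sup>M (2 t)\<^sup>N\<close> are expanded separately with \<open>2 t = 1 + s\<close>: the double series is to
  be regrouped in each of its two indices.
\<close>

lemma moment_eq_sum_centred_moments:
  "2 ^ (M + N) * (pochhammer a (M + N) / pochhammer c (M + N)) =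
     (\<Sum>m\<le>M. \<Sum>n\<le>N. of_nat (M choose m) * of_nat (N choose n) * centred_moment a c (m + n))"
proof -
  have pow: "(monom 2 1 :: complex poly) ^ M = (\<Sum>m\<le>M. of_nat (M choose m) * [:-1, 2:] ^ m)" for M
  proof -
    have "(monom 2 1 :: complex poly) = [:-1, 2:] + 1" by (simp add: monom_altdef one_pCons)
    thus ?thesis by (simp only: binomial_ring) simp
  qed
  have "smult (2 ^ (M + N)) (monom 1 (M + N)) = (monom 2 1 :: complex poly) ^ M * monom 2 1 ^ N"
    by (simp add: monom_power mult_monom smult_monom power_add)
  also have "\<dots> = (\<Sum>m\<le>M. \<Sum>n\<le>N. smult (of_nat (M choose m) * of_nat (N choose n))
                       ([:-1, 2:] ^ (m + n)))"
    unfolding pow sum_product by (simp add: of_nat_poly power_add mult_ac)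
  finally have "beta_functional a c (smult (2 ^ (M + N)) (monom 1 (M + N))) = 
     beta_functional a c (\<Sum>m\<le>M. \<Sum>n\<le>N. smult (of_nat (M choose m) * of_nat (N choose n))
                       ([:-1, 2:] ^ (m + n)))" by simp
  thus ?thesis
    by (simp only: beta_functional_sum beta_functional_smult beta_functional_monom centred_moment_def)
qed

section \<open>Binomial series\<close>

text \<open>
  The terms of the power series of \<open>(1 - x)\<^sup>-\<^sup>b\<close>.
\<close>

definition binomial_term :: "complex \<Rightarrow> complex \<Rightarrow> nat \<Rightarrow> complex" where
  "binomial_term b x n = pochhammer b n / fact n * x ^ n"

lemma binomial_term_eq_gbinomial: "binomial_term b x n = ((- b) gchoose n) * (- x) ^ n"
  by (simp add: binomial_term_def gbinomial_pochhammer power_minus[of x])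

lemma binomial_term_abs_summable:
  assumes "norm x < 1"
  shows "(\<lambda>n. norm (binomial_term b x n)) summable_on UNIV"
proof -
  have "summable (\<lambda>n. norm (((- b) gchoose n) * (- x) ^ n))"
    by (rule abs_summable_in_conv_radius)
       (use assms in \<open>auto simp: conv_radius_gchoose one_ereal_def\<close>)
  thus ?thesis
    unfolding binomial_term_eq_gbinomial by (intro norm_summable_imp_summable_on) simp
qed

lemma infsum_binomial_term:
  assumes "norm x < 1"
  shows "infsum (binomial_term b x) UNIV = (1 - x) powr (- b)"
proof -
  have "(\<lambda>n. binomial_term b x n) sums (1 + (- x)) powr (- b)"
    unfolding binomial_term_eq_gbinomial by (rule gen_binomial_complex) (use assms in simp)
  moreover have "binomial_term b x sums infsum (binomial_term b x) UNIV"
    by (intro has_sum_imp_sums has_sum_infsum abs_summable_summable[OF binomial_term_abs_summable] assms)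
  ultimately have "infsum (binomial_term b x) UNIV = (1 + (- x)) powr (- b)"
    by (intro sums_unique2)
  thus ?thesis by simp
qed

text \<open>
  This is the Taylor shift: the coefficient of index \<open>m + i\<close>, weighted by the binomial
  coefficient that arises from recentring, is the \<open>i\<close>-th term of another binomial series.
\<close>

lemma binomial_term_add:
  "binomial_term b x (m + i) * of_nat ((m + i) choose m) =
     binomial_term b x m * binomial_term (b + of_nat m) x i"
proof -
  have "of_nat ((m + i) choose m) = (fact (m + i) / (fact m * fact i) :: complex)"
    using binomial_fact[of m "m + i"] by simp
  thus ?thesis
    by (simp add: binomial_term_def pochhammer_product' power_add)
qed

lemma binomial_term_double: "binomial_term b x n = 2 ^ n * binomial_term b (x / 2) n"
  by (simp add: binomial_term_def power_divide)

text \<open>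
  Along each diagonal \<open>m + i = M\<close> the binomial coefficients add up to \<open>2 ^ M\<close>, which exactly
  compensates the argument \<open>x / 2\<close>; so the family converges in the whole unit disc.
\<close>

lemma binomial_term_shifted_abs_summable:
  assumes "norm x < 1"
  shows "(\<lambda>(m, i). norm (binomial_term b (x / 2) m * binomial_term (b + of_nat m) (x / 2) i))
           summable_on UNIV"
proof -
  have "(\<lambda>(M, m). norm (binomial_term b (x / 2) M * of_nat (M choose m)))
          summable_on Sigma UNIV (\<lambda>M. {..M})"
  proof (rule summable_on_SigmaI)
    fix M :: nat
    have "(\<Sum>m\<le>M. norm (binomial_term b (x / 2) M * of_nat (M choose m))) =
             norm (binomial_term b (x / 2) M) * of_nat (\<Sum>m\<le>M. M choose m)"
      by (simp add: norm_mult sum_distrib_left)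
    also have "\<dots> = norm (binomial_term b x M)"
      by (simp add: choose_row_sum binomial_term_double[of b x] norm_mult norm_power)
    finally show "((\<lambda>m. case (M, m) of (M, m) \<Rightarrow>
        norm (binomial_term b (x / 2) M * of_nat (M choose m)))
        has_sum norm (binomial_term b x M)) {..M}"
      by (simp add: has_sum_finiteI)
  qed (use binomial_term_abs_summable[OF assms, of b] in auto)
  also have "?this \<longleftrightarrow> ?thesis"
    by (rule summable_on_reindex_bij_witness[of _ "\<lambda>(m, i). (m + i, m)" "\<lambda>(M, m). (m, M - m)"])
       (auto simp flip: binomial_term_add)
  finally show ?thesis .
qed

section \<open>Recentring the double series\<close>

lemma norm_summable_on_prod_product:
  fixes f :: "'a \<Rightarrow> complex" and g :: "'b \<Rightarrow> complex"
  assumes f: "(\<lambda>x. norm (f x)) summable_on A" and g: "(\<lambda>y. norm (g y)) summable_on B"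
  shows "(\<lambda>(x, y). norm (f x * g y)) summable_on A \<times> B"
proof (rule summable_on_SigmaI)
  fix x
  have "((\<lambda>y. norm (f x) * norm (g y)) has_sum norm (f x) * (\<Sum>\<^sub>\<infinity>y\<in>B. norm (g y))) B"
    by (intro has_sum_cmult_right has_sum_infsum g)
  thus "((\<lambda>y. case (x, y) of (x, y) \<Rightarrow> norm (f x * g y)) has_sum
          norm (f x) * (\<Sum>\<^sub>\<infinity>y\<in>B. norm (g y))) B"
    by (simp add: norm_mult)
qed (auto intro: summable_on_cmult_left f)

lemma infsum_prod_product:
  fixes f :: "'a \<Rightarrow> complex" and g :: "'b \<Rightarrow> complex"
  assumes "(\<lambda>x. norm (f x)) summable_on A" and "(\<lambda>y. norm (g y)) summable_on B"
  shows "(\<Sum>\<^sub>\<infinity>(x, y)\<in>A \<times> B. f x * g y) = infsum f A * infsum g B"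
proof -
  have "(\<lambda>(x, y). f x * g y) summable_on A \<times> B"
    using norm_summable_on_prod_product[OF assms]
    by (rule abs_summable_summable[OF summable_on_cong[THEN iffD1, rotated]]) auto
  from infsum_Sigma_banach[OF this] show ?thesis
    by (simp add: infsum_cmult_right' infsum_cmult_left')
qed

lemma binomial_term_mult_powr:
  assumes "u \<noteq> 1"
  shows "binomial_term b u m * (1 - u) powr (- (b + of_nat m)) =
           (1 - u) powr (- b) * binomial_term b (u / (1 - u)) m"
proof -
  have "(1 - u) powr (- (b + of_nat m)) = (1 - u) powr (- b) / (1 - u) ^ m"
    using assms by (simp add: powr_diff powr_nat')
  thus ?thesis by (simp add: binomial_term_def power_divide)
qed

text \<open>
  The left-hand side integrates the product of two binomial series in \<open>t x\<close> and \<open>t y\<close> term by term.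
  Expanding \<open>t = (1 + s) / 2\<close> gives a fourfold series, absolutely convergent because the centred
  moments are bounded. Summing first over all \<open>M\<close> and \<open>N\<close> with fixed powers of \<open>s\<close> produces binomial
  series in \<open>x / 2\<close> and \<open>y / 2\<close>, that is, the expansion around \<open>s = 0\<close>.
\<close>

lemma appell_series_recentred:
  assumes "Re a > 0" "Re c > Re a" "norm x < 1" "norm y < 1"
  shows "(\<Sum>\<^sub>\<infinity>(M, N)\<in>UNIV. binomial_term b x M * binomial_term b' y N *
             (pochhammer a (M + N) / pochhammer c (M + N))) =
         (1 - x / 2) powr (- b) * (1 - y / 2) powr (- b') *
         (\<Sum>\<^sub>\<infinity>(m, n)\<in>UNIV. binomial_term b (x / (2 - x)) m * binomial_term b' (y / (2 - y)) n *
             centred_moment a c (m + n))"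
proof -
  define U where "U = centred_moment a c"
  define P where "P b x m i = binomial_term b (x / 2) m * binomial_term (b + of_nat m) (x / 2) i"
    for b x m i
  define G where "G = (\<lambda>((m, n), (i, j)). P b x m i * P b' y n j * U (m + n))"
  define H where "H = (\<lambda>((M, N), (m, n)).
      binomial_term b (x / 2) M * of_nat (M choose m) *
      (binomial_term b' (y / 2) N * of_nat (N choose n)) * U (m + n))"
  define T where "T = Sigma UNIV (\<lambda>(M, N). {..M::nat} \<times> {..N::nat})"
  obtain K where K: "\<And>n. norm (U n) \<le> K"
    using centred_moment_bounded[OF assms(1,2)] unfolding U_def by blast
  have "(\<lambda>((m, i), (n, j)). norm (P b x m i * P b' y n j)) summable_on UNIV"
    using norm_summable_on_prod_product[OF
        binomial_term_shifted_abs_summable[OF assms(3), of b, unfolded case_prod_unfold]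
        binomial_term_shifted_abs_summable[OF assms(4), of b', unfolded case_prod_unfold]]
    by (simp add: P_def case_prod_unfold)
  also have "?this \<longleftrightarrow> (\<lambda>((m, n), (i, j)). norm (P b x m i * P b' y n j)) summable_on UNIV"
    by (rule summable_on_reindex_bij_witness[of _
          "\<lambda>((m, n), (i, j)). ((m, i), (n, j))" "\<lambda>((m, i), (n, j)). ((m, n), (i, j))"]) auto
  finally have "(\<lambda>p. norm (case p of ((m, n), (i, j)) \<Rightarrow> P b x m i * P b' y n j) * K) summable_on UNIV"
    by (intro summable_on_cmult_left) (simp add: case_prod_unfold)
  hence "(\<lambda>p. norm (G p)) summable_on UNIV"
    by (rule Infinite_Sum.abs_summable_on_comparison_test')
       (auto simp: G_def norm_mult intro!: mult_left_mono K)
  hence sum_G: "G summable_on UNIV"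
    by (rule abs_summable_summable)

  \<comment> \<open>\<open>H\<close> lists the same terms by \<open>M = m + i\<close> and \<open>N = n + j\<close>, so that its inner sums are finite.\<close>
  have reindex: "G summable_on UNIV \<longleftrightarrow> H summable_on T" "infsum G UNIV = infsum H T"
    by (rule summable_on_reindex_bij_witness[of _
          "\<lambda>((M, N), (m, n)). ((m, n), (M - m, N - n))"
          "\<lambda>((m, n), (i, j)). ((m + i, n + j), (m, n))"]
        infsum_reindex_bij_witness[of _
          "\<lambda>((M, N), (m, n)). ((m, n), (M - m, N - n))"
          "\<lambda>((m, n), (i, j)). ((m + i, n + j), (m, n))"];
        auto simp: G_def H_def T_def P_def binomial_term_add)+

  have "(\<Sum>\<^sub>\<infinity>(M, N)\<in>UNIV. binomial_term b x M * binomial_term b' y N *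
             (pochhammer a (M + N) / pochhammer c (M + N))) =
        (\<Sum>\<^sub>\<infinity>p\<in>UNIV. \<Sum>\<^sub>\<infinity>q\<in>(case p of (M, N) \<Rightarrow> {..M} \<times> {..N}). H (p, q))"
  proof (rule infsum_cong, clarify)
    fix M N :: nat
    have "(\<Sum>\<^sub>\<infinity>q\<in>{..M} \<times> {..N}. H ((M, N), q)) = (\<Sum>m\<le>M. \<Sum>n\<le>N. H ((M, N), (m, n)))"
      by (simp add: sum.cartesian_product)
    also have "\<dots> = binomial_term b (x / 2) M * binomial_term b' (y / 2) N *
        (\<Sum>m\<le>M. \<Sum>n\<le>N. of_nat (M choose m) * of_nat (N choose n) * U (m + n))"
      by (simp add: H_def sum_distrib_left mult_ac)
    also have "\<dots> = binomial_term b x M * binomial_term b' y N *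
             (pochhammer a (M + N) / pochhammer c (M + N))"
      unfolding U_def moment_eq_sum_centred_moments[symmetric]
      by (simp add: binomial_term_double[of b x] binomial_term_double[of b' y] power_add)
    finally show "binomial_term b x M * binomial_term b' y N *
             (pochhammer a (M + N) / pochhammer c (M + N)) =
        (\<Sum>\<^sub>\<infinity>q\<in>{..M} \<times> {..N}. H ((M, N), q))" ..
  qed
  also have "\<dots> = infsum G UNIV"
    using sum_G unfolding reindex unfolding T_def by (rule infsum_Sigma_banach)
  also have "\<dots> = (\<Sum>\<^sub>\<infinity>p\<in>UNIV. \<Sum>\<^sub>\<infinity>q\<in>UNIV. G (p, q))"
    using infsum_Sigma_banach[of G UNIV "\<lambda>_. UNIV"] sum_G by simp
  also have "\<dots> = (\<Sum>\<^sub>\<infinity>p\<in>UNIV. (1 - x / 2) powr (- b) * (1 - y / 2) powr (- b') *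
         (case p of (m, n) \<Rightarrow> binomial_term b (x / (2 - x)) m * binomial_term b' (y / (2 - y)) n *
             U (m + n)))"
  proof (rule infsum_cong, clarify)
    fix m n :: nat
    have half: "norm (x / 2) < 1" "norm (y / 2) < 1" "x / 2 \<noteq> 1" "y / 2 \<noteq> 1"
      using assms(3,4) by (auto simp: norm_divide)
    have quot: "x / 2 / (1 - x / 2) = x / (2 - x)" "y / 2 / (1 - y / 2) = y / (2 - y)"
      using half by (auto simp: divide_simps)
    have "(\<Sum>\<^sub>\<infinity>q\<in>UNIV. G ((m, n), q)) =
       (\<Sum>\<^sub>\<infinity>q\<in>UNIV. binomial_term b (x / 2) m * binomial_term b' (y / 2) n * U (m + n) *
          (case q of (i, j) \<Rightarrow> binomial_term (b + of_nat m) (x / 2) i *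
             binomial_term (b' + of_nat n) (y / 2) j))"
      by (simp add: G_def P_def case_prod_unfold mult_ac)
    also have "\<dots> = binomial_term b (x / 2) m * binomial_term b' (y / 2) n * U (m + n) *
        ((1 - x / 2) powr (- (b + of_nat m)) * (1 - y / 2) powr (- (b' + of_nat n)))"
      using infsum_prod_product[OF binomial_term_abs_summable[OF half(1)]
          binomial_term_abs_summable[OF half(2)]]
      by (simp only: infsum_cmult_right' UNIV_Times_UNIV infsum_binomial_term[OF half(1)]
          infsum_binomial_term[OF half(2)])
    also have "\<dots> = (binomial_term b (x / 2) m * (1 - x / 2) powr (- (b + of_nat m))) *
        (binomial_term b' (y / 2) n * (1 - y / 2) powr (- (b' + of_nat n))) * U (m + n)"
      by (simp only: mult_ac)
    also have "\<dots> = (1 - x / 2) powr (- b) * (1 - y / 2) powr (- b') *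
         (binomial_term b (x / (2 - x)) m * binomial_term b' (y / (2 - y)) n * U (m + n))"
      unfolding binomial_term_mult_powr[OF half(3)] binomial_term_mult_powr[OF half(4)] quot
      by (simp only: mult_ac)
    finally show "(\<Sum>\<^sub>\<infinity>q\<in>UNIV. G ((m, n), q)) = (1 - x / 2) powr (- b) * (1 - y / 2) powr (- b') *
         (binomial_term b (x / (2 - x)) m * binomial_term b' (y / (2 - y)) n * U (m + n))" .
  qed
  also have "\<dots> = (1 - x / 2) powr (- b) * (1 - y / 2) powr (- b') *
         (\<Sum>\<^sub>\<infinity>(m, n)\<in>UNIV. binomial_term b (x / (2 - x)) m * binomial_term b' (y / (2 - y)) n *
             centred_moment a c (m + n))"
    unfolding U_def by (rule infsum_cmult_right')
  finally show ?thesis .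
qed

section \<open>The transformation formula\<close>

lemma pochhammer_k_eq_pochhammer:
  assumes "k > 0"
  shows "pochhammer_k k a n = of_real k ^ n * pochhammer (a / of_real k) n"
proof -
  have "pochhammer_k k a n = (\<Prod>i<n. of_real k * (a / of_real k + of_nat i))"
    unfolding pochhammer_k_def using assms by (intro prod.cong) (auto simp: field_simps)
  thus ?thesis
    by (simp add: prod.distrib pochhammer_prod lessThan_atLeast0)
qed

lemma appell_F1_k_eq_binomial_terms:
  assumes "k > 0"
  shows "appell_F1_k k \<alpha> \<beta> \<beta>' \<gamma> x y =
    (\<Sum>\<^sub>\<infinity>(m, n)\<in>UNIV. binomial_term (\<beta> / of_real k) (of_real k * x) m *
       binomial_term (\<beta>' / of_real k) (of_real k * y) n *
       (pochhammer (\<alpha> / of_real k) (m + n) / pochhammer (\<gamma> / of_real k) (m + n)))"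
  unfolding appell_F1_k_def
  by (rule infsum_cong)
     (use assms in \<open>auto simp: pochhammer_k_eq_pochhammer binomial_term_def power_mult_distrib
        power_add mult_ac\<close>)

lemma powr_mult_right_half_plane:
  fixes z w s :: complex
  assumes "Re z > 0" "Re w > 0"
  shows "(z * w) powr s = z powr s * w powr s"
proof -
  have "z \<noteq> 0" "w \<noteq> 0" using assms by auto
  moreover have "\<bar>Im (Ln z)\<bar> < pi / 2" "\<bar>Im (Ln w)\<bar> < pi / 2"
    by (rule Re_Ln_pos_lt[THEN iffD2]; use assms calculation in simp)+
  ultimately have "Ln (z * w) = Ln z + Ln w"
    by (intro Ln_times_simple) auto
  thus ?thesis
    using \<open>z \<noteq> 0\<close> \<open>w \<noteq> 0\<close> by (simp add: powr_def ring_distribs exp_add)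
qed

lemma Re_one_minus_pos:
  fixes z :: complex
  assumes "norm z < 1"
  shows "Re (1 - z) > 0"
  using complex_Re_le_cmod[of z] assms by simp

text \<open>
  The map \<open>z \<mapsto> - z / (1 - z)\<close> corresponds to the reflection of \<open>t\<close> at the midpoint: in the
  coordinate \<open>z / (2 - z)\<close> it is a change of sign.
\<close>

lemma pfaff_argument:
  fixes z w s :: complex
  assumes "norm z < 1" and "w = - (z / (1 - z))" and "norm w < 1"
  shows "(1 - z / 2) powr s = (1 - z) powr s * (1 - w / 2) powr s"
    and "w / (2 - w) = - (z / (2 - z))"
proof -
  have z: "z \<noteq> 1" "z \<noteq> 2" using assms(1) by auto
  have "1 - z / 2 = (1 - z) * (1 - w / 2)"
    using z by (simp add: assms(2) field_simps)
  moreover have "Re (1 - w / 2) > 0" "Re (1 - z) > 0"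
    using Re_one_minus_pos[OF assms(1)] Re_one_minus_pos[of "w / 2"] assms(3)
    by (auto simp: norm_divide simp del: minus_complex.sel)
  ultimately show "(1 - z / 2) powr s = (1 - z) powr s * (1 - w / 2) powr s"
    by (simp only: powr_mult_right_half_plane)
  show "w / (2 - w) = - (z / (2 - z))"
  proof -
    have "2 - w = (2 - z) / (1 - z)" using z by (simp add: assms(2) field_simps)
    thus ?thesis using z by (simp add: assms(2) divide_simps)
  qed
qed

theorem theorem9:
  fixes k :: real and \<alpha> \<beta> \<beta>' \<gamma> x y :: complex
  assumes "k > 0"
    and "Re \<gamma> > Re \<alpha>" and "Re \<alpha> > 0"
    and "norm x < 1 / k" and "norm y < 1 / k"
    and "norm (x / (1 - of_real k * x)) < 1 / k"
    and "norm (y / (1 - of_real k * y)) < 1 / k"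
  shows "appell_F1_k k \<alpha> \<beta> \<beta>' \<gamma> x y =
    (1 - of_real k * x) powr (- \<beta> / of_real k) * (1 - of_real k * y) powr (- \<beta>' / of_real k)
      * appell_F1_k k (\<gamma> - \<alpha>) \<beta> \<beta>' \<gamma>
          (- (x / (1 - of_real k * x))) (- (y / (1 - of_real k * y)))"
proof -
  define a b b' c where "a = \<alpha> / of_real k" and "b = \<beta> / of_real k"
    and "b' = \<beta>' / of_real k" and "c = \<gamma> / of_real k"
  define X Y where "X = of_real k * x" and "Y = of_real k * y"
  define X' Y' where "X' = - (X / (1 - X))" and "Y' = - (Y / (1 - Y))"
  have k: "k > 0" by fact
  have a: "Re a > 0" "Re c > Re a" "Re (c - a) > 0" "Re c > Re (c - a)" "Re c > 0"
    using assms by (simp_all add: a_def c_def divide_strict_right_mono)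
  have "norm X < 1" "norm Y < 1" "norm X' < 1" "norm Y' < 1"
    using assms by (simp_all add: X_def Y_def X'_def Y'_def norm_mult norm_divide field_simps)
  note norms = this
  define S where "S = (\<Sum>\<^sub>\<infinity>(m, n)\<in>UNIV. binomial_term b (X / (2 - X)) m *
      binomial_term b' (Y / (2 - Y)) n * centred_moment a c (m + n))"
  have "appell_F1_k k \<alpha> \<beta> \<beta>' \<gamma> x y = (1 - X / 2) powr (- b) * (1 - Y / 2) powr (- b') * S"
    unfolding appell_F1_k_eq_binomial_terms[OF k] S_def
    using appell_series_recentred[OF a(1,2) norms(1,2), of b b'] by (simp only: a_def b_def b'_def c_def X_def Y_def)
  moreover have "appell_F1_k k (\<gamma> - \<alpha>) \<beta> \<beta>' \<gamma> (- (x / (1 - of_real k * x))) (- (y / (1 - of_real k * y)))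
      = (1 - X' / 2) powr (- b) * (1 - Y' / 2) powr (- b') * S"
  proof -
    have "binomial_term b (X' / (2 - X')) m * binomial_term b' (Y' / (2 - Y')) n *
            centred_moment (c - a) c (m + n) =
          binomial_term b (X / (2 - X)) m * binomial_term b' (Y / (2 - Y)) n *
            centred_moment a c (m + n)" for m n
    proof -
      have flip: "binomial_term b (- z) n = (-1) ^ n * binomial_term b z n" for b z n
        by (simp add: binomial_term_def power_minus[of z])
      show ?thesis
        unfolding pfaff_argument(2)[OF norms(1) X'_def norms(3)]
          pfaff_argument(2)[OF norms(2) Y'_def norms(4)]
          flip centred_moment_reflect[OF a(5)]
        by (simp add: power_add mult_ac)
    qed
    hence "S = (\<Sum>\<^sub>\<infinity>(m, n)\<in>UNIV. binomial_term b (X' / (2 - X')) m *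
      binomial_term b' (Y' / (2 - Y')) n * centred_moment (c - a) c (m + n))"
      by (simp add: S_def)
    moreover have "of_real k * (- (x / (1 - of_real k * x))) = X'"
      "of_real k * (- (y / (1 - of_real k * y))) = Y'" "(\<gamma> - \<alpha>) / of_real k = c - a"
      by (simp_all add: X_def Y_def X'_def Y'_def a_def c_def diff_divide_distrib)
    ultimately show ?thesis
      using appell_series_recentred[OF a(3,4) norms(3,4), of b b']
      unfolding appell_F1_k_eq_binomial_terms[OF k] by (simp only: b_def b'_def c_def)
  qed
  ultimately show ?thesis
    unfolding pfaff_argument(1)[OF norms(1) X'_def norms(3)]
      pfaff_argument(1)[OF norms(2) Y'_def norms(4)]
    by (simp add: b_def b'_def X_def Y_def)
qed

end
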